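(* Let $G$ and $H$ be two connected graphs. For a graph $X$, let $E_{V(X)}$ and $O_{V(X)}$ denote the sets of vertices of $X$ of even degree and of odd degree in $X$, respectively. Then for the neighbourhood corona $G\star H$: (i) $\gamma_{coe}(G\star H)\ge |O_{V(G)}|\,|E_{V(H)}|+|E_{V(G)}|\,|O_{V(H)}|$; (ii) $\gamma_{coe}(G\star H)\le |V(G)|+|O_{V(G)}|\,|E_{V(H)}|+|E_{V(G)}|\,|O_{V(H)}|$.
   Context: All graphs are finite and simple. A dominating set of a graph $X=(V,E)$ is a set $D\subseteq V$ such that every vertex in $V\setminus D$ is adjacent to at least one vertex of $D$. A dominating set $D$ is a co-even dominating set if every vertex $v\in V\setminus D$ has even degree in $X$. The co-even domination number $\gamma_{coe}(X)$ is the minimum cardinality of a co-even dominating set of $X$. The neighbourhood corona $G\star H$ is the graph obtained by taking one copy of $G$ and $|V(G)|$ disjoint copies of $H$, and joining every neighbour (in $G$) of the $i$th vertex of $G$ to every vertex of the $i$th copy of $H$.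
   Formalization: Part (ii) is stated only for G with more than one vertex: for G = H = K_1 the corona is two isolated vertices, so γ_coe = 2 while the printed upper bound is 1. Part (i) is unrestricted. *)

theory Defs
  imports "Graph_Theory.Graph_Theory"
begin

text \<open>
  Finite simple graphs are the \<^locale>\<open>pair_graph\<close>s of the Graph Theory entry: finite, loop-free,
  symmetric digraphs whose arcs are pairs of vertices, so an undirected edge \<open>uv\<close> is the pair of
  arcs \<open>(u, v)\<close>, \<open>(v, u)\<close>. Hence the degree of a vertex is its out-degree (not the sum of in- and
  out-degree). Beware that \<^abbrev>\<open>dominates\<close> is the entry's name for mere adjacency.
\<close>

abbreviation degree :: "'a pair_pre_digraph \<Rightarrow> 'a \<Rightarrow> nat" where
  "degree X v \<equiv> out_degree (with_proj X) v"

lemma (in pair_graph) degree_eq_card_neighbours: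
  "degree G v = card {u \<in> pverts G. (v, u) \<in> parcs G}"
proof -
  have "out_arcs (with_proj G) v = Pair v ` {u \<in> pverts G. (v, u) \<in> parcs G}"
    by (auto simp: out_arcs_def image_iff dest: in_arcsD2)
  then show ?thesis
    by (simp add: out_degree_def card_image inj_on_def)
qed

definition even_verts :: "'a pair_pre_digraph \<Rightarrow> 'a set" where
  "even_verts X = {v \<in> pverts X. even (degree X v)}"

definition odd_verts :: "'a pair_pre_digraph \<Rightarrow> 'a set" where
  "odd_verts X = {v \<in> pverts X. odd (degree X v)}"

definition dominating_set :: "'a pair_pre_digraph \<Rightarrow> 'a set \<Rightarrow> bool" where
  "dominating_set X D \<longleftrightarrow> D \<subseteq> pverts X \<and> (\<forall>v \<in> pverts X - D. \<exists>u \<in> D. (v, u) \<in> parcs X)"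

definition coeven_dominating_set :: "'a pair_pre_digraph \<Rightarrow> 'a set \<Rightarrow> bool" where
  "coeven_dominating_set X D \<longleftrightarrow> dominating_set X D \<and> (\<forall>v \<in> pverts X - D. even (degree X v))"

definition coeven_domination_number :: "'a pair_pre_digraph \<Rightarrow> nat" (\<open>\<gamma>\<^sub>c\<^sub>o\<^sub>e\<close>) where
  "\<gamma>\<^sub>c\<^sub>o\<^sub>e X = Min {card D | D. coeven_dominating_set X D}"

lemma coeven_dominating_set_pverts: "coeven_dominating_set X (pverts X)"
  by (simp add: coeven_dominating_set_def dominating_set_def)

lemma finite_coeven_dominating_set_cards:
  assumes "finite (pverts X)"
  shows "finite {card D | D. coeven_dominating_set X D}"
proof (rule finite_subset)
  show "{card D | D. coeven_dominating_set X D} \<subseteq> card ` Pow (pverts X)"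
    by (auto simp: coeven_dominating_set_def dominating_set_def)
qed (simp add: assms)

text \<open>\<open>Inl v\<close> is the vertex \<open>v\<close> of \<open>G\<close>; \<open>Inr (i, x)\<close> is the vertex \<open>x\<close> in the copy of \<open>H\<close> belonging to \<open>i\<close>.\<close>

definition neighbourhood_corona ::
  "'a pair_pre_digraph \<Rightarrow> 'b pair_pre_digraph \<Rightarrow> ('a + 'a \<times> 'b) pair_pre_digraph" (infixl \<open>\<star>\<close> 70) where
  "G \<star> H = \<lparr>
     pverts = Inl ` pverts G \<union> Inr ` (pverts G \<times> pverts H),
     parcs = {(Inl u, Inl v) | u v. (u, v) \<in> parcs G}
       \<union> {(Inr (i, x), Inr (i, y)) | i x y. i \<in> pverts G \<and> (x, y) \<in> parcs H}
       \<union> {(Inl j, Inr (i, x)) | i j x. (i, j) \<in> parcs G \<and> x \<in> pverts H}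
       \<union> {(Inr (i, x), Inl j) | i j x. (i, j) \<in> parcs G \<and> x \<in> pverts H}\<rparr>"

lemma pair_graph_neighbourhood_corona:
  assumes "pair_graph G" "pair_graph H"
  shows "pair_graph (G \<star> H)"
proof -
  interpret G: pair_graph G by fact
  interpret H: pair_graph H by fact
  have sub: "parcs (G \<star> H) \<subseteq> pverts (G \<star> H) \<times> pverts (G \<star> H)"
    by (auto simp: neighbourhood_corona_def
        dest: G.arc_fst_in_verts G.arc_snd_in_verts H.arc_fst_in_verts H.arc_snd_in_verts)
  have fin: "finite (pverts (G \<star> H))"
    by (simp add: neighbourhood_corona_def)
  show ?thesis
  proof
    show "finite (parcs (G \<star> H))"
      using sub fin by (meson finite_SigmaI finite_subset)
    show "symmetric (with_proj (G \<star> H))"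
      unfolding symmetric_def
      by (intro symI) (auto simp: neighbourhood_corona_def dest: G.arcs_symmetric H.arcs_symmetric)
    show "fst e \<noteq> snd e" if "e \<in> parcs (G \<star> H)" for e
      using that by (auto simp: neighbourhood_corona_def dest: G.no_loops' H.no_loops')
  qed (use sub fin in auto)
qed

text \<open>
  The one-vertex graph has to be excluded as first factor in the upper bound: for \<open>G = H = K\<^sub>1\<close>
  the corona consists of two isolated vertices, so its co-even domination number is 2, whereas
  the bound evaluates to 1.
\<close>

lemma upper_bound_fails_for_one_vertex_graph:
  fixes K :: "unit pair_pre_digraph"
  defines "K \<equiv> \<lparr>pverts = {()}, parcs = {}\<rparr>"
  shows "pair_graph K" "connected K"
    and "\<gamma>\<^sub>c\<^sub>o\<^sub>e (K \<star> K) = 2"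
    and "card (pverts K) + card (odd_verts K) * card (even_verts K)
           + card (even_verts K) * card (odd_verts K) = 1"
proof -
  show "pair_graph K"
    by unfold_locales (auto simp: K_def symmetric_def sym_def)
  show "connected K"
    by (auto simp: K_def connected_def mk_symmetric_def strongly_connected_def reachable_def)
  have "coeven_dominating_set (K \<star> K) D \<longleftrightarrow> D = pverts (K \<star> K)" for D
    by (auto simp: coeven_dominating_set_def dominating_set_def neighbourhood_corona_def K_def)
  moreover have "card (pverts (K \<star> K)) = 2"
    by (simp add: neighbourhood_corona_def K_def)
  ultimately show "\<gamma>\<^sub>c\<^sub>o\<^sub>e (K \<star> K) = 2"
    by (simp add: coeven_domination_number_def)
  have "degree K () = 0"
    by (simp add: out_degree_def out_arcs_def K_def)
  then have "odd_verts K = {}"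
    by (auto simp: odd_verts_def)
  then show "card (pverts K) + card (odd_verts K) * card (even_verts K)
           + card (even_verts K) * card (odd_verts K) = 1"
    by (simp add: K_def)
qed

end

theory Submission
  imports Defs
begin

text \<open>
  The vertex \<open>x\<close> of the \<open>i\<close>-th copy of \<open>H\<close> has degree \<open>deg x + deg i\<close> in \<open>G \<star> H\<close>, so the copy
  vertices of odd degree are counted by the common summand of both bounds. Every co-even dominating
  set contains all of them. Conversely, adding all vertices of \<open>G\<close> to them makes the set dominating,
  because every vertex of a connected graph \<open>G\<close> with more than one vertex has a neighbour.
\<close>

lemma coeven_domination_number_le:
  assumes "finite (pverts X)" "coeven_dominating_set X D"
  shows "\<gamma>\<^sub>c\<^sub>o\<^sub>e X \<le> card D"
  unfolding coeven_domination_number_def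
  by (rule Min_le) (use assms finite_coeven_dominating_set_cards in auto)

text \<open>\<open>Min\<close> has its intended meaning only on a finite nonempty set; here it is
  nonempty because the whole vertex set is co-even dominating.\<close>

lemma coeven_domination_number_attained:
  assumes "finite (pverts X)"
  obtains D where "coeven_dominating_set X D" "\<gamma>\<^sub>c\<^sub>o\<^sub>e X = card D"
proof -
  have "\<gamma>\<^sub>c\<^sub>o\<^sub>e X \<in> {card D | D. coeven_dominating_set X D}"
    unfolding coeven_domination_number_def
    by (rule Min_in)
      (use assms finite_coeven_dominating_set_cards coeven_dominating_set_pverts in blast)+
  then show thesis
    using that by blast
qed

lemma (in pair_graph) connected_imp_neighbour:
  assumes "connected G" "card (pverts G) \<noteq> 1" "v \<in> pverts G"
  obtains u where "(v, u) \<in> parcs G"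
proof -
  have "pverts G \<noteq> {v}"
    using assms(2) by auto
  then obtain w where w: "w \<in> pverts G" "w \<noteq> v"
    using assms(3) by blast
  have "strongly_connected G"
    using assms(1) sym_arcs by (rule symmetric_connected_imp_strongly_connected[rotated])
  then have "v \<rightarrow>\<^sup>*\<^bsub>with_proj G\<^esub> w"
    using assms(3) w(1) by (simp add: strongly_connected_def)
  \<comment> \<open>Since \<open>w\<close> differs from \<open>v\<close>, the walk from
    \<open>v\<close> to \<open>w\<close> is nontrivial, and its first arc leads to the required
    neighbour.\<close>
  then show thesis
    using w(2) that by (auto elim: converse_reachable_cases)
qed

text \<open>The neighbours of a copy vertex split into those of \<open>x\<close> within the same
  copy and, in the central copy of \<open>G\<close>, those of \<open>i\<close>.\<close>

lemma degree_neighbourhood_corona_copy: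
  assumes "pair_graph G" "pair_graph H" "i \<in> pverts G" "x \<in> pverts H"
  shows "degree (G \<star> H) (Inr (i, x)) = degree H x + degree G i"
proof -
  interpret G: pair_graph G by fact
  interpret H: pair_graph H by fact
  interpret GH: pair_graph "G \<star> H"
    by (rule pair_graph_neighbourhood_corona) fact+
  let ?H = "{y \<in> pverts H. (x, y) \<in> parcs H}" and ?G = "{j \<in> pverts G. (i, j) \<in> parcs G}"
  have "{u \<in> pverts (G \<star> H). (Inr (i, x), u) \<in> parcs (G \<star> H)} = (\<lambda>y. Inr (i, y)) ` ?H \<union> Inl ` ?G"
    using assms(3,4) by (auto simp: neighbourhood_corona_def)
  moreover have "card ((\<lambda>y. Inr (i, y)) ` ?H \<union> Inl ` ?G) = card ?H + card ?G"
    by (subst card_Un_disjoint) (auto simp: card_image inj_on_def)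
  ultimately show ?thesis
    by (simp only: G.degree_eq_card_neighbours H.degree_eq_card_neighbours
        GH.degree_eq_card_neighbours)
qed

text \<open>Written through products of parity classes instead of degrees in the corona, so that the
  cardinality can be read off; the next lemma recovers the degree description, a sum being odd iff
  exactly one summand is.\<close>

definition odd_copy_verts :: "'a pair_pre_digraph \<Rightarrow> 'b pair_pre_digraph \<Rightarrow> ('a + 'a \<times> 'b) set" where
  "odd_copy_verts G H = Inr ` (odd_verts G \<times> even_verts H \<union> even_verts G \<times> odd_verts H)"

lemma odd_copy_verts_iff:
  assumes "pair_graph G" "pair_graph H" "i \<in> pverts G" "x \<in> pverts H"
  shows "Inr (i, x) \<in> odd_copy_verts G H \<longleftrightarrow> odd (degree (G \<star> H) (Inr (i, x)))"
  using assms(3,4)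
  by (auto simp: odd_copy_verts_def odd_verts_def even_verts_def
      degree_neighbourhood_corona_copy[OF assms])

lemma odd_copy_verts_subset: "odd_copy_verts G H \<subseteq> Inr ` (pverts G \<times> pverts H)"
  by (auto simp: odd_copy_verts_def odd_verts_def even_verts_def)

text \<open>The two products are disjoint, since no degree in \<open>G\<close> is both odd and even,
  and \<open>Inr\<close> is injective.\<close>

lemma card_odd_copy_verts:
  assumes "finite (pverts G)" "finite (pverts H)"
  shows "card (odd_copy_verts G H) =
    card (odd_verts G) * card (even_verts H) + card (even_verts G) * card (odd_verts H)"
proof -
  have "card (odd_verts G \<times> even_verts H \<union> even_verts G \<times> odd_verts H) =
      card (odd_verts G \<times> even_verts H) + card (even_verts G \<times> odd_verts H)"
    by (rule card_Un_disjoint) (use assms in \<open>auto simp: odd_verts_def even_verts_def\<close>)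
  then show ?thesis
    by (simp add: odd_copy_verts_def card_image card_cartesian_product)
qed

lemma odd_copy_verts_subset_coeven_dominating_set:
  assumes "pair_graph G" "pair_graph H" "coeven_dominating_set (G \<star> H) D"
  shows "odd_copy_verts G H \<subseteq> D"
proof
  fix v assume v: "v \<in> odd_copy_verts G H"
  then obtain i x where ix: "v = Inr (i, x)" "i \<in> pverts G" "x \<in> pverts H"
    using odd_copy_verts_subset by blast
  then have "odd (degree (G \<star> H) v)"
    using v odd_copy_verts_iff[OF assms(1,2)] by blast
  moreover have "v \<in> pverts (G \<star> H)"
    using ix by (auto simp: neighbourhood_corona_def)
  ultimately show "v \<in> D"
    using assms(3) by (auto simp: coeven_dominating_set_def)
qed

lemma coeven_dominating_set_neighbourhood_corona:
  assumes "pair_graph G" "connected G" "pair_graph H" "card (pverts G) \<noteq> 1"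
  shows "coeven_dominating_set (G \<star> H) (Inl ` pverts G \<union> odd_copy_verts G H)" (is "coeven_dominating_set _ ?D")
proof -
  interpret G: pair_graph G by fact
  have "?D \<subseteq> pverts (G \<star> H)"
    using odd_copy_verts_subset by (auto simp: neighbourhood_corona_def)
  moreover have "(\<exists>u \<in> ?D. (v, u) \<in> parcs (G \<star> H)) \<and> even (degree (G \<star> H) v)"
    if v: "v \<in> pverts (G \<star> H) - ?D" for v
  proof -
    obtain i x where ix: "v = Inr (i, x)" "i \<in> pverts G" "x \<in> pverts H"
      using v by (auto simp: neighbourhood_corona_def)
    \<comment> \<open>A neighbour \<open>j\<close> of \<open>i\<close> is joined to the entire copy
      belonging to \<open>i\<close>, so \<open>Inl j\<close> dominates \<open>v\<close>. The
      one-vertex graph offers no such \<open>j\<close>.\<close>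
    obtain j where j: "(i, j) \<in> parcs G"
      using G.connected_imp_neighbour[OF assms(2,4) ix(2)] .
    then have "Inl j \<in> ?D" "(v, Inl j) \<in> parcs (G \<star> H)"
      using ix by (auto simp: neighbourhood_corona_def dest: G.in_arcsD2)
    moreover have "even (degree (G \<star> H) v)"
      using v ix odd_copy_verts_iff[OF assms(1,3)] by blast
    ultimately show ?thesis
      by blast
  qed
  ultimately show ?thesis
    by (simp add: coeven_dominating_set_def dominating_set_def)
qed

theorem theorem3p1:
  fixes G :: "'a pair_pre_digraph" and H :: "'b pair_pre_digraph"
  assumes "pair_graph G" and "connected G"
    and "pair_graph H" and "connected H"
  shows "\<gamma>\<^sub>c\<^sub>o\<^sub>e (G \<star> H) \<ge>
           card (odd_verts G) * card (even_verts H) + card (even_verts G) * card (odd_verts H) \<and>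
         (card (pverts G) \<noteq> 1 \<longrightarrow>
         \<gamma>\<^sub>c\<^sub>o\<^sub>e (G \<star> H) \<le> card (pverts G) +
           card (odd_verts G) * card (even_verts H) + card (even_verts G) * card (odd_verts H))"
proof (intro conjI impI)
  interpret G: pair_graph G by fact
  interpret H: pair_graph H by fact
  interpret GH: pair_graph "G \<star> H"
    by (rule pair_graph_neighbourhood_corona) fact+
  note card_odd = card_odd_copy_verts[OF G.finite_verts H.finite_verts, simplified]
  obtain D where D: "coeven_dominating_set (G \<star> H) D" "\<gamma>\<^sub>c\<^sub>o\<^sub>e (G \<star> H) = card D"
    using coeven_domination_number_attained GH.pair_finite_verts by blast
  \<comment> \<open>Infinite sets have cardinality 0 by convention, so monotonicity of
    \<open>card\<close> requires finiteness of \<open>D\<close>.\<close>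
  have "finite D"
    using D(1) GH.pair_finite_verts
    by (auto simp: coeven_dominating_set_def dominating_set_def intro: finite_subset)
  then have "card (odd_copy_verts G H) \<le> card D"
    using odd_copy_verts_subset_coeven_dominating_set[OF assms(1,3) D(1)] by (rule card_mono)
  then show "\<gamma>\<^sub>c\<^sub>o\<^sub>e (G \<star> H) \<ge>
      card (odd_verts G) * card (even_verts H) + card (even_verts G) * card (odd_verts H)"
    by (simp add: D(2) card_odd)
  assume "card (pverts G) \<noteq> 1"
  then have "\<gamma>\<^sub>c\<^sub>o\<^sub>e (G \<star> H) \<le> card (Inl ` pverts G \<union> odd_copy_verts G H)"
    using coeven_dominating_set_neighbourhood_corona assms
    by (intro coeven_domination_number_le GH.pair_finite_verts) blast
  \<comment> \<open>Subadditivity of \<open>card\<close> suffices; injectivity of \<open>Inl\<close>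
    gives the first summand.\<close>
  also have "\<dots> \<le> card (pverts G) + card (odd_copy_verts G H)"
    by (metis card_Un_le card_image inj_Inl)
  finally show "\<gamma>\<^sub>c\<^sub>o\<^sub>e (G \<star> H) \<le> card (pverts G) +
      card (odd_verts G) * card (even_verts H) + card (even_verts G) * card (odd_verts H)"
    by (simp add: card_odd)
qed

end
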